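(* There is a function $\omega$ that is continuous on the closed unit disk $\overline{\mathbf{D}}$ and whose best analytic approximant in $L^1(\mathbf{D})$ is unbounded near every point of $\partial\mathbf{D}$.
   Context: $\mathbf{D}$ is the open unit disk in $\mathbf{C}$ with normalized area measure $dA=\frac1\pi\,dx\,dy$; $A^1$ is the Bergman space of analytic functions on $\mathbf{D}$ integrable with respect to $dA$. The best analytic approximant to $\omega$ in $L^1(\mathbf{D})$ is the function $f^\star\in A^1$ minimizing $\|\omega-f\|_1$ over $f\in A^1$ (it exists, and it is unique when $\omega$ is continuous in $\mathbf{D}$). "Unbounded near every point of $\partial\mathbf{D}$" means: for every $\zeta\in\partial\mathbf{D}$ and every neighborhood $U$ of $\zeta$, the function is unbounded on $U\cap\mathbf{D}$. *)

theory Defs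
  imports "HOL-Complex_Analysis.Complex_Analysis"
begin

(* The measure lives on the disk itself (not on the whole plane), so the values that a function
   complex => complex takes outside the disk affect neither its measurability nor its integral. *)
definition disk_area :: "complex measure" where
  "disk_area = density (restrict_space lborel (ball 0 1)) (\<lambda>_. ennreal (1 / pi))"

definition bergman_A1 :: "(complex \<Rightarrow> complex) set" where
  "bergman_A1 = {f. f holomorphic_on ball 0 1 \<and> integrable disk_area f}"

(* This is the L^1 norm only for integrable functions: the Bochner integral is 0 otherwise. *)
definition L1_disk_norm :: "(complex \<Rightarrow> complex) \<Rightarrow> real" where
  "L1_disk_norm h = (\<integral>z. norm (h z) \<partial>disk_area)"

definition best_analytic_approximant ::
    "(complex \<Rightarrow> complex) \<Rightarrow> (complex \<Rightarrow> complex) \<Rightarrow> bool" where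
  "best_analytic_approximant \<omega> f \<longleftrightarrow>
     integrable disk_area \<omega> \<and> f \<in> bergman_A1 \<and>
     (\<forall>g \<in> bergman_A1. L1_disk_norm (\<lambda>z. \<omega> z - f z) \<le> L1_disk_norm (\<lambda>z. \<omega> z - g z))"

definition unbounded_near_every_boundary_point :: "(complex \<Rightarrow> complex) \<Rightarrow> bool" where
  "unbounded_near_every_boundary_point f \<longleftrightarrow>
     (\<forall>\<zeta> \<in> sphere 0 1. \<forall>U. open U \<and> \<zeta> \<in> U \<longrightarrow> \<not> bounded (f ` (U \<inter> ball 0 1)))"

end

theory Submission
  imports Defs
begin

text \<open>A radial function \<open>\<phi>\<close> with values \<open>\<plusminus>1\<close> and mean zero annihilates the Bergman space, by the area
  mean value property. So \<open>F\<close> is a best approximant of \<open>\<omega>\<close> as soon as \<open>\<omega> - F\<close> is real with sign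
  \<open>\<phi>\<close>. Take \<open>F\<close> unbounded near every boundary point, with positive real part and with an imaginary
  part that extends continuously to the closed disk, and let \<open>\<omega> = \<chi> * Re F + \<i> * Im F\<close> for a
  decreasing radial cutoff \<open>\<chi>\<close> that equals \<open>1\<close> on the circle \<open>(norm z)\<^sup>2 = 1/2\<close>; then
  \<open>\<omega> - F = (\<chi> - 1) * Re F\<close>. A suitable \<open>F\<close> is the sum of rotations, to a dense sequence of boundary
  points, of \<open>csqrt (2 - Ln (1 - z))\<close> with geometric weights: its imaginary part is a bounded quantity
  divided by its unbounded real part. Since \<open>\<omega> - F\<close> vanishes only on that circle, a second best
  approximant differs from \<open>F\<close> by a real constant, and the sign condition makes the constant \<open>0\<close>.\<close>

section \<open>Rotation invariance and the area mean value property\<close>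

lemma measurable_Complex_lborel_pair:
  "(\<lambda>(x, y). Complex x y) \<in> borel_measurable (lborel \<Otimes>\<^sub>M lborel)"
  unfolding lborel_prod measurable_lborel2 case_prod_unfold Complex_eq
  by (intro borel_measurable_continuous_onI continuous_intros)

text \<open>Lebesgue measure is determined by its values on boxes, and a complex box pulls back to a
  product of two intervals.\<close>

lemma lborel_complex_eq_distr:
  "(lborel :: complex measure) = distr (lborel \<Otimes>\<^sub>M lborel) borel (\<lambda>(x, y). Complex x y)"
proof (rule lborel_eqI)
  fix l u :: complex
  assume le: "\<And>b. b \<in> Basis \<Longrightarrow> l \<bullet> b \<le> u \<bullet> b"
  have lu: "Re l \<le> Re u" "Im l \<le> Im u"
    using le[of 1] le[of \<i>] by (auto simp: Basis_complex_def)
  have vimage: "(\<lambda>(x, y). Complex x y) -` box l u = {Re l<..<Re u} \<times> {Im l<..<Im u}"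
    by (auto simp: in_box_complex_iff)
  have "emeasure (distr (lborel \<Otimes>\<^sub>M lborel) borel (\<lambda>(x, y). Complex x y)) (box l u)
      = emeasure (lborel \<Otimes>\<^sub>M lborel) ({Re l<..<Re u} \<times> {Im l<..<Im u})"
    using emeasure_distr[OF measurable_Complex_lborel_pair, of "box l u"] by (simp add: vimage space_pair_measure)
  also have "\<dots> = ennreal (Re u - Re l) * ennreal (Im u - Im l)"
    using lu by (subst lborel.emeasure_pair_measure_Times) auto
  also have "\<dots> = ennreal (\<Prod>b\<in>Basis. (u - l) \<bullet> b)"
    using lu by (simp add: Basis_complex_def ennreal_mult)
  finally show "emeasure (distr (lborel \<Otimes>\<^sub>M lborel) borel (\<lambda>(x, y). Complex x y)) (box l u)
      = ennreal (\<Prod>b\<in>Basis. (u - l) \<bullet> b)" .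
qed simp

text \<open>Tonelli in both orders: each of the two shears below acts as a translation of one
  coordinate, which has to be the inner variable.\<close>

lemma
  fixes f :: "complex \<Rightarrow> ennreal"
  assumes [measurable]: "f \<in> borel_measurable borel"
  shows nn_integral_lborel_complex_Re_Im:
      "(\<integral>\<^sup>+z. f z \<partial>lborel) = (\<integral>\<^sup>+x. (\<integral>\<^sup>+y. f (Complex x y) \<partial>lborel) \<partial>lborel)"
    and nn_integral_lborel_complex_Im_Re:
      "(\<integral>\<^sup>+z. f z \<partial>lborel) = (\<integral>\<^sup>+y. (\<integral>\<^sup>+x. f (Complex x y) \<partial>lborel) \<partial>lborel)"
proof -
  note measurable_Complex_lborel_pair[measurable]
  have "(\<integral>\<^sup>+z. f z \<partial>lborel) = (\<integral>\<^sup>+p. f (case p of (x, y) \<Rightarrow> Complex x y) \<partial>(lborel \<Otimes>\<^sub>M lborel))"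
    by (subst lborel_complex_eq_distr, subst nn_integral_distr) auto
  note eq = this
  show "(\<integral>\<^sup>+z. f z \<partial>lborel) = (\<integral>\<^sup>+x. (\<integral>\<^sup>+y. f (Complex x y) \<partial>lborel) \<partial>lborel)"
    unfolding eq by (subst lborel.nn_integral_fst[symmetric]) auto
  show "(\<integral>\<^sup>+z. f z \<partial>lborel) = (\<integral>\<^sup>+y. (\<integral>\<^sup>+x. f (Complex x y) \<partial>lborel) \<partial>lborel)"
    unfolding eq by (subst lborel_pair.nn_integral_snd[symmetric]) auto
qed

lemma nn_integral_lborel_shear_Re:
  fixes f :: "complex \<Rightarrow> ennreal"
  assumes [measurable]: "f \<in> borel_measurable borel"
  shows "(\<integral>\<^sup>+z. f (z + of_real (a * Im z)) \<partial>lborel) = (\<integral>\<^sup>+z. f z \<partial>lborel)"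
proof -
  have "(\<integral>\<^sup>+x. f (Complex (x + a * y) y) \<partial>lborel) = (\<integral>\<^sup>+x. f (Complex x y) \<partial>lborel)" for y
    using nn_integral_real_affine[of "\<lambda>x. f (Complex x y)" 1 "a * y"]
    by (simp add: Complex_eq add.commute)
  moreover have "Complex x y + of_real (a * y) = Complex (x + a * y) y" for x y
    by (simp add: complex_eq_iff)
  ultimately show ?thesis
    by (subst (1 2) nn_integral_lborel_complex_Im_Re) simp_all
qed

lemma nn_integral_lborel_shear_Im:
  fixes f :: "complex \<Rightarrow> ennreal"
  assumes [measurable]: "f \<in> borel_measurable borel"
  shows "(\<integral>\<^sup>+z. f (z + \<i> * of_real (b * Re z)) \<partial>lborel) = (\<integral>\<^sup>+z. f z \<partial>lborel)"
proof -
  have "(\<integral>\<^sup>+y. f (Complex x (y + b * x)) \<partial>lborel) = (\<integral>\<^sup>+y. f (Complex x y) \<partial>lborel)" for x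
    using nn_integral_real_affine[of "\<lambda>y. f (Complex x y)" 1 "b * x"]
    by (simp add: Complex_eq add.commute)
  moreover have "Complex x y + \<i> * of_real (b * x) = Complex x (y + b * x)" for x y
    by (simp add: complex_eq_iff)
  ultimately show ?thesis
    by (subst (1 2) nn_integral_lborel_complex_Re_Im) simp_all
qed

text \<open>A rotation other than \<open>\<plusminus>1\<close> is a product of three shears, and \<open>-1 = \<i> * \<i>\<close>.\<close>

lemma nn_integral_lborel_rotate:
  fixes f :: "complex \<Rightarrow> ennreal"
  assumes f: "f \<in> borel_measurable borel" and c: "norm c = 1"
  shows "(\<integral>\<^sup>+z. f (c * z) \<partial>lborel) = (\<integral>\<^sup>+z. f z \<partial>lborel)"
proof -
  have rotate: "(\<integral>\<^sup>+z. g (d * z) \<partial>lborel) = (\<integral>\<^sup>+z. g z \<partial>lborel)"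
    if [measurable]: "g \<in> borel_measurable borel" and d: "norm d = 1" "Im d \<noteq> 0"
    for g :: "complex \<Rightarrow> ennreal" and d
  proof -
    \<comment> \<open>For \<open>d = cis t\<close> this is -tan(t/2), the parameter for which the
      shears \<open>X\<close>, \<open>Y\<close>, \<open>X\<close> compose to multiplication by
      \<open>d\<close>.\<close>
    define a where "a = (Re d - 1) / Im d"
    define X where "X z = z + of_real (a * Im z)" for z
    define Y where "Y z = z + \<i> * of_real (Im d * Re z)" for z
    have [measurable]: "X \<in> borel_measurable borel" "Y \<in> borel_measurable borel"
      unfolding X_def Y_def by measurable
    have sq: "(Re d)\<^sup>2 + (Im d)\<^sup>2 = 1"
      using d by (simp add: cmod_def)
    have a: "a * Im d = Re d - 1"
      using d by (simp add: a_def)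
    have "a * (Re d + 1) = - Im d"
      using d sq by (simp add: a_def field_simps power2_eq_square)
    then have a': "a * Re d = - Im d - a"
      by (simp add: algebra_simps)
    have "X (Y (X z)) = d * z" for z
    proof (rule complex_eqI)
      have "Re (X (Y (X z))) = (1 + a * Im d) * Re z + (2 * a + a * (a * Im d)) * Im z"
        by (simp add: X_def Y_def algebra_simps)
      also have "\<dots> = Re (d * z)"
        unfolding a by (simp add: algebra_simps a')
      finally show "Re (X (Y (X z))) = Re (d * z)" .
      have "Im (X (Y (X z))) = Im d * Re z + (1 + a * Im d) * Im z"
        by (simp add: X_def Y_def algebra_simps)
      also have "\<dots> = Im (d * z)"
        unfolding a by (simp add: algebra_simps)
      finally show "Im (X (Y (X z))) = Im (d * z)" .
    qed
    then have "(\<integral>\<^sup>+z. g (d * z) \<partial>lborel) = (\<integral>\<^sup>+z. g (X (Y (X z))) \<partial>lborel)"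
      by simp
    also have "\<dots> = (\<integral>\<^sup>+z. g (X (Y z)) \<partial>lborel)"
      using nn_integral_lborel_shear_Re[of "\<lambda>z. g (X (Y z))" a] by (simp add: X_def)
    also have "\<dots> = (\<integral>\<^sup>+z. g (X z) \<partial>lborel)"
      using nn_integral_lborel_shear_Im[of "\<lambda>z. g (X z)" "Im d"] by (simp add: Y_def)
    also have "\<dots> = (\<integral>\<^sup>+z. g z \<partial>lborel)"
      using nn_integral_lborel_shear_Re[of g a] by (simp add: X_def)
    finally show ?thesis .
  qed
  show ?thesis
  proof (cases "Im c = 0")
    case False
    then show ?thesis using rotate f c by blast
  next
    case True
    then have "\<bar>Re c\<bar> = 1"
      using c by (simp add: cmod_def)
    then have "c = 1 \<or> c = \<i> * \<i>"
      using True by (auto simp: complex_eq_iff)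
    then show ?thesis
    proof
      assume "c = \<i> * \<i>"
      then have "(\<integral>\<^sup>+z. f (c * z) \<partial>lborel) = (\<integral>\<^sup>+z. f (\<i> * (\<i> * z)) \<partial>lborel)"
        by (simp only: mult.assoc)
      also have "\<dots> = (\<integral>\<^sup>+z. f (\<i> * z) \<partial>lborel)"
        using f by (intro rotate[of "\<lambda>z. f (\<i> * z)"]) auto
      also have "\<dots> = (\<integral>\<^sup>+z. f z \<partial>lborel)"
        using f by (intro rotate) auto
      finally show ?thesis .
    qed simp
  qed
qed

lemma lborel_distr_rotate:
  assumes "norm c = 1"
  shows "distr lborel borel (\<lambda>z. c * z) = (lborel :: complex measure)"
proof (rule measure_eqI)
  fix A :: "complex set"
  assume "A \<in> sets (distr lborel borel (\<lambda>z. c * z))"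
  then have [measurable]: "A \<in> sets borel" by simp
  have "emeasure (distr lborel borel (\<lambda>z. c * z)) A = (\<integral>\<^sup>+z. indicator A z \<partial>distr lborel borel (\<lambda>z. c * z))"
    by simp
  also have "\<dots> = (\<integral>\<^sup>+z. indicator A (c * z) \<partial>lborel)"
    by (rule nn_integral_distr) auto
  also have "\<dots> = (\<integral>\<^sup>+z. indicator A z \<partial>lborel)"
    by (rule nn_integral_lborel_rotate) (use assms in auto)
  finally show "emeasure (distr lborel borel (\<lambda>z. c * z)) A = emeasure lborel A"
    by simp
qed simp

section \<open>The normalized area measure of the disk\<close>

lemma space_disk_area [simp]: "space disk_area = ball 0 1"
  by (simp add: disk_area_def space_restrict_space)

lemma sets_disk_area: "sets disk_area = sets (restrict_space borel (ball 0 1))"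
  by (simp add: disk_area_def sets_restrict_space)

lemma borel_measurable_disk_area_continuous:
  assumes "continuous_on (ball 0 1) f"
  shows "f \<in> borel_measurable disk_area"
  using borel_measurable_continuous_on_restrict[OF assms]
  by (simp add: measurable_cong_sets[OF sets_disk_area refl])

lemma borel_measurable_disk_area_indicator_ball [measurable]:
  "(indicator (ball 0 r) :: complex \<Rightarrow> real) \<in> borel_measurable disk_area"
proof -
  have "(indicator (ball 0 r) :: complex \<Rightarrow> real) \<in> borel_measurable borel"
    by (rule borel_measurable_indicator) auto
  then show ?thesis
    using measurable_restrict_space1 measurable_cong_sets[OF sets_disk_area refl] by blast
qed

lemma emeasure_disk_area:
  assumes "A \<in> sets disk_area"
  shows "emeasure disk_area A = ennreal (1 / pi) * emeasure lborel A"
proof -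
  have A: "A \<in> sets (restrict_space lborel (ball 0 1))" "A \<subseteq> ball 0 1"
    using assms sets.sets_into_space[OF assms] by (simp_all add: disk_area_def)
  then have "emeasure disk_area A
      = ennreal (1 / pi) * emeasure (restrict_space lborel (ball 0 1)) A"
    by (simp add: disk_area_def emeasure_density nn_integral_cmult_indicator)
  then show ?thesis
    using A by (simp add: emeasure_restrict_space)
qed

lemma ball_in_sets_disk_area:
  assumes "r \<le> 1"
  shows "ball 0 r \<in> sets disk_area"
proof -
  have "ball 0 1 \<inter> ball 0 r = (ball 0 r :: complex set)"
    using assms by auto
  then show ?thesis
    unfolding sets_disk_area sets_restrict_space by (metis borel_open image_eqI open_ball)
qed

lemma measure_disk_area_ball:
  assumes "0 \<le> r" "r \<le> 1"
  shows "measure disk_area (ball 0 r) = r\<^sup>2"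
proof -
  have "emeasure disk_area (ball 0 r) = ennreal (1 / pi) * ennreal (pi * r\<^sup>2)"
    using assms by (simp add: emeasure_disk_area ball_in_sets_disk_area emeasure_ball unit_ball_vol_2)
  also have "\<dots> = ennreal (r\<^sup>2)"
    by (subst ennreal_mult[symmetric]) auto
  finally show ?thesis
    by (simp add: measure_def)
qed

lemma finite_measure_disk_area: "finite_measure disk_area"
proof
  have "emeasure disk_area (ball 0 1) = ennreal (1 / pi) * ennreal pi"
    by (simp add: emeasure_disk_area ball_in_sets_disk_area emeasure_ball unit_ball_vol_2)
  then show "emeasure disk_area (space disk_area) \<noteq> \<infinity>"
    by (simp add: ennreal_mult_eq_top_iff)
qed

interpretation disk_area: finite_measure disk_area
  by (fact finite_measure_disk_area)

text \<open>On Borel subsets of the disk the measure is Lebesgue measure divided by pi, and a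
  rotation maps the disk onto itself, so the invariance of Lebesgue measure carries over.\<close>

lemma disk_area_distr_rotate:
  assumes c: "norm c = 1"
  shows "(\<lambda>z. c * z) \<in> disk_area \<rightarrow>\<^sub>M disk_area"
    and "distr disk_area disk_area (\<lambda>z. c * z) = disk_area"
proof -
  have "(\<lambda>z. c * z) \<in> restrict_space borel (ball 0 1) \<rightarrow>\<^sub>M restrict_space borel (ball 0 1)"
    by (rule measurable_restrict_space3) (auto simp: norm_mult c)
  then show meas: "(\<lambda>z. c * z) \<in> disk_area \<rightarrow>\<^sub>M disk_area"
    by (simp add: measurable_cong_sets[OF sets_disk_area sets_disk_area])
  show "distr disk_area disk_area (\<lambda>z. c * z) = disk_area"
  proof (rule measure_eqI)
    fix A assume "A \<in> sets (distr disk_area disk_area (\<lambda>z. c * z))"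
    then have A: "A \<in> sets disk_area" by simp
    then have sub: "A \<subseteq> ball 0 1"
      using sets.sets_into_space by fastforce
    have borel: "A \<in> sets borel"
      using A by (auto simp: sets_disk_area sets_restrict_space)
    have vimage: "(\<lambda>z. c * z) -` A \<inter> ball 0 1 = (\<lambda>z. c * z) -` A"
      using sub by (auto simp: norm_mult c subset_iff)
    have "emeasure (distr disk_area disk_area (\<lambda>z. c * z)) A
        = ennreal (1 / pi) * emeasure lborel ((\<lambda>z. c * z) -` A)"
      using measurable_sets[OF meas A] A meas by (simp add: emeasure_distr emeasure_disk_area vimage)
    also have "emeasure lborel ((\<lambda>z. c * z) -` A) = emeasure (distr lborel borel (\<lambda>z. c * z)) A"
      using borel by (subst emeasure_distr) auto
    also have "\<dots> = emeasure lborel A"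
      by (simp add: lborel_distr_rotate c)
    finally show "emeasure (distr disk_area disk_area (\<lambda>z. c * z)) A = emeasure disk_area A"
      using A by (simp add: emeasure_disk_area)
  qed simp
qed

lemma integral_disk_area_rotate:
  fixes f :: "complex \<Rightarrow> 'a::{banach, second_countable_topology}"
  assumes "f \<in> borel_measurable disk_area" "norm c = 1"
  shows "(\<integral>z. f (c * z) \<partial>disk_area) = (\<integral>z. f z \<partial>disk_area)"
  using integral_distr[OF disk_area_distr_rotate(1) assms(1), of c]
  by (simp add: disk_area_distr_rotate assms)

text \<open>A rotation by \<open>c\<close> with \<open>c ^ n = -1\<close> preserves the integral and
  also changes its sign.\<close>

lemma integral_disk_area_power:
  assumes "n > 0" "r \<le> 1"
  shows "(\<integral>z. indicator (ball 0 r) z *\<^sub>R z ^ n \<partial>disk_area) = 0"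
proof -
  define c where "c = cis (pi / real n)"
  have c: "norm c = 1" "c ^ n = -1"
    using assms by (simp_all add: c_def Complex.DeMoivre)
  have "(\<integral>z. indicator (ball 0 r) z *\<^sub>R z ^ n \<partial>disk_area)
      = (\<integral>z. indicator (ball 0 r) (c * z) *\<^sub>R (c * z) ^ n \<partial>disk_area)"
    using c by (intro integral_disk_area_rotate[symmetric] borel_measurable_scaleR
        borel_measurable_disk_area_indicator_ball borel_measurable_disk_area_continuous
        continuous_intros)
  also have "\<dots> = (\<integral>z. - (indicator (ball 0 r) z *\<^sub>R z ^ n) \<partial>disk_area)"
    by (simp add: power_mult_distrib c indicator_def norm_mult)
  finally show ?thesis
    by (simp add: equation_minus_iff[symmetric] complex_eq_iff)
qed

text \<open>The Taylor series is integrated term by term, with a constant dominating all partial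
  sums on the smaller disk. Only the constant term survives, multiplied by the normalized area
  \<open>r\<^sup>2\<close>.\<close>

lemma area_mean_value_inner:
  assumes hol: "f holomorphic_on ball 0 1" and r: "0 < r" "r < 1"
  shows "integrable disk_area (\<lambda>z. indicator (ball 0 r) z *\<^sub>R f z)"
    and "(\<integral>z. indicator (ball 0 r) z *\<^sub>R f z \<partial>disk_area) = of_real (r\<^sup>2) * f 0"
proof -
  define a where "a n = (deriv ^^ n) f 0 / fact n" for n
  have sums: "(\<lambda>n. a n * z ^ n) sums f z" if "norm z < 1" for z
    using holomorphic_power_series[OF hol, of z] that by (simp add: a_def)
  \<comment> \<open>The intermediate radius (1 + r)/2 still lies in the disk of convergence, which
    gives absolute convergence at radius \<open>r\<close>.\<close>
  have "summable (\<lambda>n. norm (a n * of_real r ^ n))"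
  proof (rule powser_insidea)
    show "summable (\<lambda>n. a n * of_real ((1 + r) / 2) ^ n)"
      using r by (intro sums_summable[OF sums]) (simp del: of_real_add of_real_divide)
    show "norm (complex_of_real r) < norm (complex_of_real ((1 + r) / 2))"
      using r by (simp del: of_real_add of_real_divide)
  qed
  then have abs: "summable (\<lambda>n. norm (a n) * r ^ n)"
    using r by (simp add: norm_mult norm_power)
  define K where "K = (\<Sum>n. norm (a n) * r ^ n)"
  define s where "s N z = indicator (ball 0 r) z *\<^sub>R (\<Sum>n<N. a n * z ^ n)" for N z
  have [measurable]: "f \<in> borel_measurable disk_area"
    using hol by (intro borel_measurable_disk_area_continuous holomorphic_on_imp_continuous_on)
  have s_meas [measurable]: "s N \<in> borel_measurable disk_area" for N
    unfolding s_def
    by (intro borel_measurable_scaleR borel_measurable_disk_area_indicator_ball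
        borel_measurable_disk_area_continuous continuous_intros)
  have lim: "(\<lambda>N. s N z) \<longlonglongrightarrow> indicator (ball 0 r) z *\<^sub>R f z" if "z \<in> ball 0 1" for z
    using sums[of z] that unfolding s_def sums_def by (intro tendsto_intros) auto
  have bound: "norm (s N z) \<le> K" for N z
  proof (cases "z \<in> ball 0 r")
    case True
    then have "norm (s N z) \<le> (\<Sum>n<N. norm (a n) * norm z ^ n)"
      unfolding s_def by (auto intro!: sum_norm_le simp: norm_mult norm_power)
    also have "\<dots> \<le> (\<Sum>n<N. norm (a n) * r ^ n)"
      using True by (intro sum_mono mult_left_mono power_mono) auto
    also have "\<dots> \<le> K"
      unfolding K_def using abs r by (intro sum_le_suminf) auto
    finally show ?thesis .
  next
    case False
    then show ?thesis
      unfolding s_def K_def using r abs by (auto intro!: suminf_nonneg)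
  qed
  have "(\<lambda>z. indicator (ball 0 r) z *\<^sub>R f z) \<in> borel_measurable disk_area"
    by measurable
  note dc = this s_meas disk_area.integrable_const[of K]
    AE_I2[of disk_area, simplified, OF lim] AE_I2[of disk_area, OF bound]
  show "integrable disk_area (\<lambda>z. indicator (ball 0 r) z *\<^sub>R f z)"
    by (rule integrable_dominated_convergence[OF dc]) auto
  have lim_integral: "(\<lambda>N. \<integral>z. s N z \<partial>disk_area) \<longlonglongrightarrow> (\<integral>z. indicator (ball 0 r) z *\<^sub>R f z \<partial>disk_area)"
    by (rule integral_dominated_convergence[OF dc]) auto
  \<comment> \<open>The shift to \<open>Suc N\<close> excludes the empty sum, which lacks the
    constant term.\<close>
  have "(\<integral>z. s (Suc N) z \<partial>disk_area) = of_real (r\<^sup>2) * f 0" for N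
  proof -
    have inter: "ball 0 r \<inter> ball 0 1 = (ball 0 r :: complex set)"
      using r by (intro Int_absorb2 subset_ball) simp
    have int: "integrable disk_area (\<lambda>z. indicator (ball 0 r) z *\<^sub>R z ^ n)" for n
    proof (rule disk_area.integrable_const_bound)
      show "AE z in disk_area. norm (indicator (ball 0 r) z *\<^sub>R z ^ n) \<le> 1"
        using r by (intro AE_I2) (auto simp: indicator_def norm_power intro!: power_le_one)
      show "(\<lambda>z. indicator (ball 0 r) z *\<^sub>R z ^ n) \<in> borel_measurable disk_area"
        by (intro borel_measurable_scaleR borel_measurable_disk_area_indicator_ball
            borel_measurable_disk_area_continuous continuous_intros)
    qed
    have "(\<integral>z. s (Suc N) z \<partial>disk_area)
        = (\<integral>z. (\<Sum>n<Suc N. a n * (indicator (ball 0 r) z *\<^sub>R z ^ n)) \<partial>disk_area)"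
      by (simp only: s_def scaleR_sum_right mult_scaleR_right)
    also have "\<dots> = (\<Sum>n<Suc N. a n * (\<integral>z. indicator (ball 0 r) z *\<^sub>R z ^ n \<partial>disk_area))"
      using int by (subst Bochner_Integration.integral_sum) (auto simp del: mult_scaleR_right)
    also have "\<dots> = a 0 * (\<integral>z. indicator (ball 0 r) z *\<^sub>R 1 \<partial>disk_area)"
      using r by (subst sum.lessThan_Suc_shift) (simp add: integral_disk_area_power del: power_Suc)
    also have "\<dots> = of_real (r\<^sup>2) * f 0"
      using r by (simp add: a_def inter ball_in_sets_disk_area measure_disk_area_ball
          scaleR_conv_of_real)
    finally show ?thesis .
  qed
  then show "(\<integral>z. indicator (ball 0 r) z *\<^sub>R f z \<partial>disk_area) = of_real (r\<^sup>2) * f 0"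
    using LIMSEQ_unique[OF LIMSEQ_Suc[OF lim_integral]] by simp
qed

text \<open>Let the radius tend to 1 in the previous identity; integrability of \<open>f\<close>
  provides the dominating function.\<close>

lemma area_mean_value:
  assumes "f \<in> bergman_A1"
  shows "(\<integral>z. f z \<partial>disk_area) = f 0"
proof -
  \<comment> \<open>The 2 in the denominator keeps the first radius positive.\<close>
  define r where "r n = 1 - 1 / real (n + 2)" for n
  have r: "0 < r n" "r n < 1" for n
    by (auto simp: r_def field_simps)
  have r_lim: "r \<longlonglongrightarrow> 1"
    unfolding r_def by real_asymp
  have f: "f holomorphic_on ball 0 1" "integrable disk_area f"
    using assms by (auto simp: bergman_A1_def)
  have lim: "(\<lambda>n. indicator (ball 0 (r n)) z *\<^sub>R f z) \<longlonglongrightarrow> f z" if "z \<in> ball 0 1" for z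
  proof (rule tendsto_eventually)
    have "eventually (\<lambda>n. norm z < r n) sequentially"
      using that r_lim by (intro order_tendstoD(1)) auto
    then show "eventually (\<lambda>n. indicator (ball 0 (r n)) z *\<^sub>R f z = f z) sequentially"
      by eventually_elim auto
  qed
  have "(\<lambda>n. \<integral>z. indicator (ball 0 (r n)) z *\<^sub>R f z \<partial>disk_area) \<longlonglongrightarrow> (\<integral>z. f z \<partial>disk_area)"
  proof (rule integral_dominated_convergence)
    show "integrable disk_area (\<lambda>z. norm (f z))"
      using f by auto
    show "(\<lambda>z. indicator (ball 0 (r n)) z *\<^sub>R f z) \<in> borel_measurable disk_area" for n
      using area_mean_value_inner(1)[OF f(1) r, of n] by auto
    show "AE z in disk_area. (\<lambda>n. indicator (ball 0 (r n)) z *\<^sub>R f z) \<longlonglongrightarrow> f z"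
      using lim by (intro AE_I2) auto
    show "AE z in disk_area. norm (indicator (ball 0 (r n)) z *\<^sub>R f z) \<le> norm (f z)" for n
      by (auto simp: indicator_def)
  qed (use f in auto)
  moreover have "(\<lambda>n. \<integral>z. indicator (ball 0 (r n)) z *\<^sub>R f z \<partial>disk_area) \<longlonglongrightarrow> of_real (1\<^sup>2) * f 0"
    unfolding area_mean_value_inner(2)[OF f(1) r] by (intro tendsto_intros r_lim)
  ultimately show ?thesis
    using LIMSEQ_unique by fastforce
qed

section \<open>A sum of logarithmic singularities with continuous imaginary part\<close>

lemma sqrt_Re_le_Re_csqrt: "sqrt (Re w) \<le> Re (csqrt w)"
  using complex_Re_le_cmod[of w] by simp

text \<open>With \<open>s = csqrt w\<close> one has Im w = 2 Re s Im s, and Re s is at least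
  \<open>sqrt (Re w)\<close>. A large real part of \<open>w\<close> thus makes the imaginary part of
  the root small.\<close>

lemma abs_Im_csqrt_le:
  assumes "0 < Re w"
  shows "\<bar>Im (csqrt w)\<bar> \<le> \<bar>Im w\<bar> / (2 * sqrt (Re w))"
proof -
  define s where "s = csqrt w"
  have s: "w = s\<^sup>2" "sqrt (Re w) \<le> Re s"
    using sqrt_Re_le_Re_csqrt[of w] by (simp_all add: s_def del: csqrt.simps)
  have "\<bar>Im s\<bar> * (2 * sqrt (Re w)) \<le> \<bar>Im s\<bar> * (2 * Re s)"
    using s(2) by (intro mult_left_mono) auto
  also have "\<dots> = \<bar>Im s * (2 * Re s)\<bar>"
    using s(2) assms by (simp add: abs_mult) (smt (verit) real_sqrt_ge_zero)
  also have "Im s * (2 * Re s) = Im w"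
    by (simp add: s(1) power2_eq_square)
  finally show ?thesis
    using assms by (simp add: s_def[symmetric] pos_le_divide_eq)
qed

text \<open>\<open>Ln 0\<close> is unspecified. The value \<open>csqrt 2\<close> at the singularity \<open>1\<close> has imaginary part \<open>0\<close>,
  the limit of the imaginary part from inside the disk.\<close>

definition sqrt_log :: "complex \<Rightarrow> complex" where
  "sqrt_log z = csqrt (2 - (if z = 1 then 0 else Ln (1 - z)))"

context
  fixes z :: complex
  assumes z: "norm z \<le> 1" "z \<noteq> 1"
begin

text \<open>The closed disk touches the line Re z = 1 only at 1. Hence 1 - z avoids the branch cut
  of \<open>Ln\<close> and its argument stays below pi/2 in absolute value.\<close>

lemma Re_one_minus_pos: "0 < Re (1 - z)"
proof -
  have "Re z \<noteq> 1"
  proof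
    assume Re: "Re z = 1"
    have "(Re z)\<^sup>2 + (Im z)\<^sup>2 \<le> 1"
      using z(1) by (simp add: cmod_def)
    then show False
      using z(2) Re by (simp add: complex_eq_iff)
  qed
  then show ?thesis
    using complex_Re_le_cmod[of z] z(1) by simp
qed

lemma Re_two_minus_Ln: "Re (2 - Ln (1 - z)) = 2 - ln (norm (1 - z))"
  using z by simp

text \<open>This explains the constant 2 in \<open>sqrt_log\<close>: on the disk |1 - z| is at most
  2 and ln 2 is at most 1.\<close>

lemma Re_two_minus_Ln_ge: "1 \<le> Re (2 - Ln (1 - z))"
proof -
  have "norm (1 - z) \<le> 2"
    using norm_triangle_ineq4[of 1 z] z by simp
  then have "ln (norm (1 - z)) \<le> ln 2"
    using z by (subst ln_le_cancel_iff) auto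
  then show ?thesis
    using ln_le_minus_one[of 2] by (simp add: Re_two_minus_Ln del: minus_complex.sel)
qed

lemma one_le_Re_sqrt_log': "1 \<le> Re (sqrt_log z)"
proof -
  have "1 \<le> sqrt (Re (2 - Ln (1 - z)))"
    using Re_two_minus_Ln_ge by simp
  then show ?thesis
    using sqrt_Re_le_Re_csqrt[of "2 - Ln (1 - z)"]
    unfolding sqrt_log_def if_not_P[OF z(2)] by (rule order_trans)
qed

text \<open>The radicand has imaginary part at most pi/2 < 2 in absolute value, while its real part
  grows without bound near 1. The resulting bound tends to 0 at 1.\<close>

lemma abs_Im_sqrt_log_le': "\<bar>Im (sqrt_log z)\<bar> \<le> 1 / sqrt (2 - ln (norm (1 - z)))"
proof -
  have pos: "0 < 2 - ln (norm (1 - z))"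
    using Re_two_minus_Ln_ge unfolding Re_two_minus_Ln by linarith
  have "\<bar>Im (2 - Ln (1 - z))\<bar> \<le> 2"
    using Re_Ln_pos_lt_imp[OF Re_one_minus_pos] pi_less_4 by simp
  moreover have "\<bar>Im (sqrt_log z)\<bar> \<le> \<bar>Im (2 - Ln (1 - z))\<bar> / (2 * sqrt (2 - ln (norm (1 - z))))"
    using abs_Im_csqrt_le[of "2 - Ln (1 - z)"] pos z unfolding sqrt_log_def Re_two_minus_Ln by simp
  ultimately have "\<bar>Im (sqrt_log z)\<bar> \<le> 2 / (2 * sqrt (2 - ln (norm (1 - z))))"
    using pos by (smt (verit) divide_right_mono real_sqrt_ge_zero)
  then show ?thesis by simp
qed

end

lemma one_le_Re_sqrt_log: "norm z \<le> 1 \<Longrightarrow> 1 \<le> Re (sqrt_log z)"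
  by (cases "z = 1") (use one_le_Re_sqrt_log' in \<open>auto simp: sqrt_log_def simp del: csqrt.simps\<close>)

lemma abs_Im_sqrt_log_le:
  assumes "norm z \<le> 1"
  shows "\<bar>Im (sqrt_log z)\<bar> \<le> 1"
proof (cases "z = 1")
  case False
  have "1 \<le> 2 - ln (norm (1 - z))"
    using Re_two_minus_Ln_ge[OF assms False] unfolding Re_two_minus_Ln[OF assms False] .
  then have "1 / sqrt (2 - ln (norm (1 - z))) \<le> 1"
    by simp
  then show ?thesis
    using abs_Im_sqrt_log_le'[OF assms False] by linarith
qed (simp add: sqrt_log_def del: csqrt.simps)

lemma sqrt_log_args_notin_nonpos_Reals:
  assumes "norm z \<le> 1" "z \<noteq> 1"
  shows "1 - z \<notin> \<real>\<^sub>\<le>\<^sub>0" "2 - Ln (1 - z) \<notin> \<real>\<^sub>\<le>\<^sub>0"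
  using Re_one_minus_pos[OF assms] Re_two_minus_Ln_ge[OF assms]
  by (auto simp: complex_nonpos_Reals_iff)

lemma holomorphic_sqrt_log: "sqrt_log holomorphic_on ball 0 1"
proof -
  have "(\<lambda>z. csqrt (2 - Ln (1 - z))) holomorphic_on ball 0 1"
  proof (intro holomorphic_intros)
    fix z :: complex assume "z \<in> ball 0 1"
    then have "norm z \<le> 1" "z \<noteq> 1" by auto
    from sqrt_log_args_notin_nonpos_Reals[OF this]
    show "1 - z \<notin> \<real>\<^sub>\<le>\<^sub>0" "2 - Ln (1 - z) \<notin> \<real>\<^sub>\<le>\<^sub>0" .
  qed
  then show ?thesis
    by (rule holomorphic_transform) (auto simp: sqrt_log_def)
qed

text \<open>Away from 1 the function \<open>sqrt_log\<close> itself is continuous; at 1 the bound on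
  the imaginary part forces the limit 0, which is the value assigned there.\<close>

lemma continuous_on_Im_sqrt_log: "continuous_on (cball 0 1) (\<lambda>z. Im (sqrt_log z))"
  unfolding continuous_on_def
proof
  fix z :: complex assume z: "z \<in> cball 0 1"
  show "((\<lambda>z. Im (sqrt_log z)) \<longlongrightarrow> Im (sqrt_log z)) (at z within cball 0 1)"
  proof (cases "z = 1")
    case False
    have "isCont (\<lambda>z. csqrt (2 - Ln (1 - z))) z"
      using sqrt_log_args_notin_nonpos_Reals[of z] z False
      by (intro isCont_csqrt' isCont_Ln' continuous_intros) auto
    then have "((\<lambda>z. csqrt (2 - Ln (1 - z))) \<longlongrightarrow> sqrt_log z) (at z within cball 0 1)"
      using False by (simp add: isCont_def sqrt_log_def tendsto_within_subset[OF _ subset_UNIV])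
    moreover have "eventually (\<lambda>w. w \<noteq> 1) (at z within cball 0 1)"
      using False by (rule tendsto_imp_eventually_ne[OF tendsto_ident_at])
    then have "eventually (\<lambda>w. csqrt (2 - Ln (1 - w)) = sqrt_log w) (at z within cball 0 1)"
      by eventually_elim (simp add: sqrt_log_def)
    ultimately have "(sqrt_log \<longlongrightarrow> sqrt_log z) (at z within cball 0 1)"
      by (rule Lim_transform_eventually)
    then show ?thesis
      by (rule tendsto_Im)
  next
    case True
    have "filterlim (\<lambda>z :: complex. norm (1 - z)) (at_right 0) (at 1)"
      unfolding filterlim_at by (auto intro!: tendsto_eq_intros simp: eventually_at_filter)
    then have "((\<lambda>z :: complex. 1 / sqrt (2 - ln (norm (1 - z)))) \<longlongrightarrow> 0) (at 1)"
      by (rule filterlim_compose[rotated]) real_asymp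
    then have lim: "((\<lambda>z :: complex. 1 / sqrt (2 - ln (norm (1 - z)))) \<longlongrightarrow> 0) (at 1 within cball 0 1)"
      by (rule tendsto_within_subset) simp
    have "eventually (\<lambda>z. norm (Im (sqrt_log z)) \<le> 1 / sqrt (2 - ln (norm (1 - z))))
        (at 1 within cball 0 1)"
      using abs_Im_sqrt_log_le' by (auto simp: eventually_at_filter)
    then have "((\<lambda>z. Im (sqrt_log z)) \<longlongrightarrow> 0) (at 1 within cball 0 1)"
      using lim by (rule Lim_null_comparison)
    then show ?thesis
      by (simp add: True sqrt_log_def del: csqrt.simps)
  qed
qed

text \<open>On the radius the real part dominates \<open>sqrt (2 - ln (1 - t))\<close>.\<close>

lemma filterlim_Re_sqrt_log: "filterlim (\<lambda>t. Re (sqrt_log (of_real t))) at_top (at_left 1)"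
proof (rule filterlim_at_top_mono)
  have "filterlim (\<lambda>t :: real. 1 - t) (at_right 0) (at_left 1)"
    unfolding filterlim_at by (auto intro!: tendsto_eq_intros simp: eventually_at_filter)
  then show "filterlim (\<lambda>t :: real. sqrt (2 - ln (1 - t))) at_top (at_left 1)"
    by (rule filterlim_compose[rotated]) real_asymp
  have "eventually (\<lambda>t :: real. 0 < t \<and> t < 1) (at_left 1)"
    using eventually_at_left_real[of 0 1] by simp
  then show "eventually (\<lambda>t. sqrt (2 - ln (1 - t)) \<le> Re (sqrt_log (of_real t))) (at_left 1)"
  proof eventually_elim
    case (elim t)
    have of_real: "1 - complex_of_real t = of_real (1 - t)"
      by simp
    have norm: "norm (1 - complex_of_real t) = 1 - t"
      unfolding of_real norm_of_real using elim by simp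
    show ?case
      using sqrt_Re_le_Re_csqrt[of "2 - Ln (1 - of_real t)"] Re_two_minus_Ln[of "of_real t"] elim
      by (simp add: norm sqrt_log_def del: csqrt.simps)
  qed
qed

section \<open>Superposition of singularities over the dense set of boundary points with rational
  angle in radians\<close>

definition circle_point :: "nat \<Rightarrow> complex" where
  "circle_point n = cis (of_rat (from_nat n))"

lemma norm_circle_point [simp]: "norm (circle_point n) = 1"
  by (simp add: circle_point_def)

lemma circle_point_dense:
  assumes "open U" "\<zeta> \<in> U" "norm \<zeta> = 1"
  obtains n where "circle_point n \<in> U"
proof -
  obtain t where t: "\<zeta> = cis t"
    using assms(3) unfolding complex_norm_eq_1_exp cis_conv_exp by metis
  have "open (cis -` U)"
    using assms(1) by (intro open_vimage continuous_intros) 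
  then obtain e where e: "e > 0" "\<And>y. dist y t < e \<Longrightarrow> cis y \<in> U"
    using assms(2) t unfolding open_dist by (metis vimage_eq)
  obtain q where q: "t < real_of_rat q" "real_of_rat q < t + e"
    using of_rat_dense[of t "t + e"] e(1) by auto
  have "circle_point (to_nat q) \<in> U"
    unfolding circle_point_def using q by (simp add: e(2) dist_real_def)
  then show thesis ..
qed

text \<open>The factor \<open>cnj (circle_point n)\<close> rotates \<open>circle_point n\<close> to
  1, so the n-th term is singular at \<open>circle_point n\<close>.\<close>

definition sqrt_log_sum :: "complex \<Rightarrow> complex" where
  "sqrt_log_sum z = (\<Sum>n. of_real ((1/2) ^ n) * sqrt_log (z * cnj (circle_point n)))"

text \<open>A separate series because the imaginary parts of the terms are bounded by 1 on the whole
  closed disk, so it converges on the boundary as well.\<close>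

definition Im_sqrt_log_sum :: "complex \<Rightarrow> real" where
  "Im_sqrt_log_sum z = (\<Sum>n. (1/2) ^ n * Im (sqrt_log (z * cnj (circle_point n))))"

text \<open>Rotations preserve the compact disk of radius \<open>r\<close>, so one bound serves all
  \<open>n\<close>.\<close>

lemma sqrt_log_bounded_inner:
  assumes "r < 1"
  shows "\<exists>M. \<forall>n z. norm z \<le> r \<longrightarrow> norm (sqrt_log (z * cnj (circle_point n))) \<le> M"
proof -
  have "continuous_on (cball 0 r) sqrt_log"
    using assms by (intro holomorphic_on_imp_continuous_on holomorphic_on_subset[OF holomorphic_sqrt_log]) auto
  then have "bounded (sqrt_log ` cball 0 r)"
    by (intro compact_imp_bounded compact_continuous_image) auto
  then obtain M where "\<forall>w \<in> sqrt_log ` cball 0 r. norm w \<le> M"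
    unfolding bounded_iff by blast
  then show ?thesis
    by (intro exI[of _ M]) (auto simp: norm_mult)
qed

lemma
  assumes "r < 1"
  shows uniform_limit_sqrt_log_sum: "uniform_limit (cball 0 r)
      (\<lambda>N z. \<Sum>n<N. of_real ((1/2) ^ n) * sqrt_log (z * cnj (circle_point n))) sqrt_log_sum sequentially"
    and summable_sqrt_log_sum_inner:
      "norm z \<le> r \<Longrightarrow> summable (\<lambda>n. of_real ((1/2) ^ n) * sqrt_log (z * cnj (circle_point n)))"
proof -
  obtain M where M: "\<And>n z. norm z \<le> r \<Longrightarrow> norm (sqrt_log (z * cnj (circle_point n))) \<le> M"
    using sqrt_log_bounded_inner[OF assms] by blast
  have bound: "norm (of_real ((1/2) ^ n) * sqrt_log (z * cnj (circle_point n))) \<le> (1/2) ^ n * M"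
    if "norm z \<le> r" for n z
    using M[OF that, of n] by (simp add: norm_mult norm_power mult_left_mono)
  have summable: "summable (\<lambda>n. (1/2) ^ n * M)"
    by (intro summable_mult2 summable_geometric) simp
  show "uniform_limit (cball 0 r)
      (\<lambda>N z. \<Sum>n<N. of_real ((1/2) ^ n) * sqrt_log (z * cnj (circle_point n))) sqrt_log_sum sequentially"
    unfolding sqrt_log_sum_def[abs_def]
    by (rule Weierstrass_m_test[OF _ summable]) (use bound in auto)
  show "summable (\<lambda>n. of_real ((1/2) ^ n) * sqrt_log (z * cnj (circle_point n)))" if "norm z \<le> r"
    by (rule summable_comparison_test'[OF summable bound[OF that]])
qed

lemma summable_sqrt_log_sum:
  "norm z < 1 \<Longrightarrow> summable (\<lambda>n. of_real ((1/2) ^ n) * sqrt_log (z * cnj (circle_point n)))"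
  using summable_sqrt_log_sum_inner[of "norm z" z] by simp

lemma holomorphic_sqrt_log_sum: "sqrt_log_sum holomorphic_on ball 0 1"
proof (rule holomorphic_uniform_sequence)
  show "(\<lambda>z. \<Sum>n<N. of_real ((1/2) ^ n) * sqrt_log (z * cnj (circle_point n))) holomorphic_on ball 0 1" for N
  proof (intro holomorphic_intros)
    fix n
    have "(sqrt_log \<circ> (\<lambda>z. z * cnj (circle_point n))) holomorphic_on ball 0 1"
      by (rule holomorphic_on_compose_gen[OF _ holomorphic_sqrt_log])
        (auto intro!: holomorphic_intros simp: norm_mult)
    then show "(\<lambda>z. sqrt_log (z * cnj (circle_point n))) holomorphic_on ball 0 1"
      by (simp add: o_def)
  qed
  fix z :: complex assume z: "z \<in> ball 0 1"
  \<comment> \<open>Half the distance to the unit circle: the closed disk of radius \<open>d\<close>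
    about \<open>z\<close> stays in a centered disk of radius below 1, where convergence is
    uniform.\<close>
  define d where "d = (1 - norm z) / 2"
  have d: "0 < d" "d + norm z < 1"
    using z by (auto simp: d_def field_simps)
  have sub: "cball z d \<subseteq> cball 0 (d + norm z)"
    by (simp add: cball_subset_cball_iff)
  then have "cball z d \<subseteq> ball 0 1"
    using d by (auto simp: subset_iff)
  then show "\<exists>d>0. cball z d \<subseteq> ball 0 1 \<and> uniform_limit (cball z d)
      (\<lambda>N z. \<Sum>n<N. of_real ((1/2) ^ n) * sqrt_log (z * cnj (circle_point n))) sqrt_log_sum sequentially"
    using d uniform_limit_on_subset[OF uniform_limit_sqrt_log_sum[OF d(2)] sub] by blast
qed simp

lemma Im_sqrt_log_sum:
  assumes "norm z < 1"
  shows "Im (sqrt_log_sum z) = Im_sqrt_log_sum z"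
  unfolding sqrt_log_sum_def Im_sqrt_log_sum_def
  by (subst Im_suminf[OF summable_sqrt_log_sum[OF assms]]) simp

text \<open>All terms have positive real part, so no singularity is cancelled by the others and each
  single term is a lower bound.\<close>

lemma Re_sqrt_log_sum_ge:
  assumes "norm z < 1"
  shows "(1/2) ^ n * Re (sqrt_log (z * cnj (circle_point n))) \<le> Re (sqrt_log_sum z)"
proof -
  let ?f = "\<lambda>n. (1/2) ^ n * Re (sqrt_log (z * cnj (circle_point n)))"
  have nonneg: "0 \<le> ?f n" for n
    using one_le_Re_sqrt_log[of "z * cnj (circle_point n)"] assms by (simp add: norm_mult)
  have "summable ?f"
    using summable_Re[OF summable_sqrt_log_sum[OF assms]] by simp
  then have "sum ?f {n} \<le> suminf ?f"
    using nonneg by (intro sum_le_suminf) auto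
  also have "suminf ?f = Re (sqrt_log_sum z)"
    unfolding sqrt_log_sum_def by (subst Re_suminf[OF summable_sqrt_log_sum[OF assms]]) simp
  finally show ?thesis by simp
qed

lemma Re_sqrt_log_sum_pos:
  assumes "norm z < 1"
  shows "0 < Re (sqrt_log_sum z)"
  using Re_sqrt_log_sum_ge[OF assms, of 0] one_le_Re_sqrt_log[of "z * cnj (circle_point 0)"] assms
  by (simp add: norm_mult)

text \<open>The series of continuous imaginary parts has the majorant \<open>(1/2) ^ n\<close> on
  the closed disk, hence converges uniformly up to the boundary.\<close>

lemma continuous_on_Im_sqrt_log_sum: "continuous_on (cball 0 1) Im_sqrt_log_sum"
proof (rule uniform_limit_theorem)
  let ?f = "\<lambda>n z. (1/2) ^ n * Im (sqrt_log (z * cnj (circle_point n)))"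
  show "uniform_limit (cball 0 1) (\<lambda>N z. \<Sum>n<N. ?f n z) Im_sqrt_log_sum sequentially"
    unfolding Im_sqrt_log_sum_def[abs_def]
  proof (rule Weierstrass_m_test)
    show "norm (?f n z) \<le> (1/2) ^ n" if "z \<in> cball 0 1" for n z
      using that abs_Im_sqrt_log_le[of "z * cnj (circle_point n)"] 
      by (simp add: norm_mult abs_mult)
  qed (rule summable_geometric, simp)
  have "continuous_on (cball 0 1) (\<lambda>z. Im (sqrt_log (z * cnj (circle_point n))))" for n
    by (rule continuous_on_compose2[OF continuous_on_Im_sqrt_log])
      (auto intro!: continuous_intros simp: norm_mult)
  then show "\<forall>\<^sub>F N in sequentially. continuous_on (cball 0 1) (\<lambda>z. \<Sum>n<N. ?f n z)"
    by (intro always_eventually allI continuous_on_sum continuous_on_mult continuous_on_const)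
qed simp

text \<open>Every neighborhood of a boundary point contains some \<open>circle_point n\<close>;
  along the radius to it the n-th term alone exceeds any bound.\<close>

lemma unbounded_sqrt_log_sum: "unbounded_near_every_boundary_point sqrt_log_sum"
  unfolding unbounded_near_every_boundary_point_def
proof (intro ballI allI impI, elim conjE, rule notI)
  fix \<zeta> U assume "\<zeta> \<in> sphere (0 :: complex) 1" and U: "open U" "\<zeta> \<in> U"
    and "bounded (sqrt_log_sum ` (U \<inter> ball 0 1))"
  then obtain B where "\<forall>w \<in> sqrt_log_sum ` (U \<inter> ball 0 1). norm w \<le> B"
    unfolding bounded_iff by blast
  then have B: "norm (sqrt_log_sum z) \<le> B" if "z \<in> U" "norm z < 1" for z
    using that by simp
  obtain n where n: "circle_point n \<in> U"
    using circle_point_dense[OF U] \<open>\<zeta> \<in> sphere 0 1\<close> by auto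
  have "((\<lambda>t. of_real t * circle_point n) \<longlongrightarrow> of_real 1 * circle_point n) (at_left 1)"
    by (intro tendsto_intros)
  then have "eventually (\<lambda>t. of_real t * circle_point n \<in> U) (at_left 1)"
    using U(1) n by (intro topological_tendstoD) auto
  \<comment> \<open>The factor \<open>2 ^ n\<close> compensates for the weight of the n-th
    term.\<close>
  moreover have "eventually (\<lambda>t. B * 2 ^ n < Re (sqrt_log (of_real t))) (at_left 1)"
    using filterlim_Re_sqrt_log by (simp add: filterlim_at_top_dense)
  moreover have "eventually (\<lambda>t :: real. t \<in> {0<..<1}) (at_left 1)"
    by (rule eventually_at_left_real) simp
  ultimately have "eventually (\<lambda>t :: real. False) (at_left 1)"
  proof eventually_elim
    case (elim t)
    let ?z = "of_real t * circle_point n"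
    have "circle_point n * cnj (circle_point n) = 1"
      by (simp add: complex_norm_square[symmetric])
    then have z: "?z * cnj (circle_point n) = of_real t"
      by (simp add: mult.assoc)
    have norm: "norm ?z < 1"
      using elim by (simp add: norm_mult)
    have "(1/2) ^ n * Re (sqrt_log (of_real t)) \<le> Re (sqrt_log_sum ?z)"
      using Re_sqrt_log_sum_ge[OF norm, of n] unfolding z .
    also have "\<dots> \<le> B"
      using B[of ?z] elim norm complex_Re_le_cmod[of "sqrt_log_sum ?z"] by linarith
    finally show False
      using elim by (simp add: power_divide field_simps)
  qed
  then show False
    by (simp add: eventually_False)
qed

text \<open>The real part is positive and its integrals over inner disks converge by the mean value
  property, so monotone convergence applies. The imaginary part is bounded.\<close>

lemma sqrt_log_sum_bergman: "sqrt_log_sum \<in> bergman_A1"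
proof -
  let ?F = sqrt_log_sum
  define r where "r n = 1 - 1 / real (n + 2)" for n
  have r: "0 < r n" "r n < 1" for n
    by (auto simp: r_def field_simps)
  have r_mono: "r m \<le> r n" if "m \<le> n" for m n
    using that by (auto simp: r_def intro!: divide_left_mono)
  have r_lim: "r \<longlonglongrightarrow> 1"
    unfolding r_def by real_asymp
  have cont: "continuous_on (ball 0 1) ?F"
    by (intro holomorphic_on_imp_continuous_on holomorphic_sqrt_log_sum)
  have "integrable disk_area (\<lambda>z. Re (?F z))"
  proof (rule integral_monotone_convergence_nonneg)
    let ?f = "\<lambda>n z. Re (indicator (ball 0 (r n)) z *\<^sub>R ?F z)"
    note mv = area_mean_value_inner[OF holomorphic_sqrt_log_sum r]
    show "integrable disk_area (?f n)" for n
      using mv(1) by (rule integrable_Re)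
    show "AE z in disk_area. mono (\<lambda>n. ?f n z)"
    proof (intro AE_I2 monoI)
      fix z m n assume "z \<in> space disk_area" "m \<le> (n :: nat)"
      then show "?f m z \<le> ?f n z"
        using Re_sqrt_log_sum_pos[of z] r_mono[of m n] by (auto simp: indicator_def)
    qed
    show "AE z in disk_area. 0 \<le> ?f n z" for n
      using Re_sqrt_log_sum_pos by (intro AE_I2) (auto simp: indicator_def less_imp_le)
    show "AE z in disk_area. (\<lambda>n. ?f n z) \<longlonglongrightarrow> Re (?F z)"
    proof (intro AE_I2 tendsto_eventually)
      fix z assume "z \<in> space disk_area"
      then have "eventually (\<lambda>n. norm z < r n) sequentially"
        using r_lim by (intro order_tendstoD(1)) auto
      then show "eventually (\<lambda>n. ?f n z = Re (?F z)) sequentially"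
        by eventually_elim auto
    qed
    have "(\<lambda>n. Re (of_real ((r n)\<^sup>2) * ?F 0)) \<longlonglongrightarrow> Re (of_real (1\<^sup>2) * ?F 0)"
      by (intro tendsto_intros r_lim)
    then show "(\<lambda>n. \<integral>z. ?f n z \<partial>disk_area) \<longlonglongrightarrow> Re (of_real (1\<^sup>2) * ?F 0)"
      using mv by (simp only: integral_Re)
    show "(\<lambda>z. Re (?F z)) \<in> borel_measurable disk_area"
      using cont by (intro borel_measurable_disk_area_continuous continuous_intros)
  qed
  moreover have "integrable disk_area (\<lambda>z. Im (?F z))"
  proof -
    have "bounded (Im_sqrt_log_sum ` cball 0 1)"
      by (intro compact_imp_bounded compact_continuous_image continuous_on_Im_sqrt_log_sum) auto
    then obtain B where "\<forall>w \<in> Im_sqrt_log_sum ` cball 0 1. norm w \<le> B"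
      unfolding bounded_iff by blast
    then show ?thesis
      using cont by (intro disk_area.integrable_const_bound[where B = B] AE_I2
          borel_measurable_disk_area_continuous continuous_intros) (auto simp: Im_sqrt_log_sum)
  qed
  ultimately have "integrable disk_area (\<lambda>z. of_real (Re (?F z)) + \<i> * of_real (Im (?F z)))"
    by (intro Bochner_Integration.integrable_add integrable_mult_right integrable_of_real)
  then show ?thesis
    using holomorphic_sqrt_log_sum by (simp add: bergman_A1_def complex_eq[symmetric])
qed

section \<open>Duality and the continuous target\<close>

text \<open>The points of \<open>U\<close> where \<open>h\<close> is nonzero form an open null set,
  hence the empty set. This turns almost-everywhere sign conditions into pointwise ones.\<close>

lemma continuous_AE_disk_area_eq_0:
  fixes h :: "complex \<Rightarrow> real"
  assumes U: "open U" "U \<subseteq> ball 0 1" and cont: "continuous_on U h"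
    and AE: "AE z in disk_area. z \<in> U \<longrightarrow> h z = 0" and z: "z \<in> U"
  shows "h z = 0"
proof -
  define V where "V = U \<inter> h -` (- {0})"
  have "open V"
    unfolding V_def using U cont by (intro continuous_open_preimage) auto
  have sub: "V \<subseteq> ball 0 1"
    using U(2) by (auto simp: V_def)
  have sets: "V \<in> sets disk_area"
    unfolding sets_disk_area sets_restrict_space using \<open>open V\<close> sub
    by (intro image_eqI[of _ _ V]) auto
  have "{z \<in> space disk_area. \<not> (z \<in> U \<longrightarrow> h z = 0)} = V"
    using sub by (auto simp: V_def)
  then have "emeasure disk_area V = 0"
    using AE_iff_measurable[OF sets] AE by simp
  then have "emeasure lborel V = 0"
    using sets by (simp add: emeasure_disk_area)
  then have "V \<in> null_sets lborel"
    using \<open>open V\<close> by (intro null_setsI) auto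
  then have "negligible V"
    unfolding negligible_iff_null_sets by (rule null_sets_completionI)
  then have "V = {}"
    using open_not_negligible[OF \<open>open V\<close>] by blast
  then show ?thesis
    using z by (auto simp: V_def)
qed

text \<open>The integral of \<open>\<phi> * Re (\<omega> - g)\<close> does not depend on \<open>g\<close>; it is at most the distance from
  \<open>\<omega>\<close> to \<open>g\<close>, with equality for \<open>f\<close>.\<close>

lemma
  fixes \<phi> :: "complex \<Rightarrow> real"
  assumes \<omega>: "integrable disk_area \<omega>" and f: "f \<in> bergman_A1"
    and meas: "\<phi> \<in> borel_measurable disk_area" and le1: "\<And>z. \<bar>\<phi> z\<bar> \<le> 1"
    and annihilates: "\<And>g. g \<in> bergman_A1 \<Longrightarrow> (\<integral>z. \<phi> z *\<^sub>R g z \<partial>disk_area) = 0"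
    and sign: "\<And>z. z \<in> ball 0 1 \<Longrightarrow> \<phi> z * Re (\<omega> z - f z) = norm (\<omega> z - f z)"
  shows best_analytic_approximant_dual: "best_analytic_approximant \<omega> f"
    and best_analytic_approximant_sign: "\<And>g. best_analytic_approximant \<omega> g \<Longrightarrow>
      AE z in disk_area. \<phi> z * Re (\<omega> z - g z) = norm (\<omega> z - g z)"
proof -
  have bound: "\<phi> z * Re w \<le> norm w" for z w
  proof -
    have "\<phi> z * Re w \<le> \<bar>\<phi> z\<bar> * \<bar>Re w\<bar>"
      by (metis abs_ge_self abs_mult)
    also have "\<dots> \<le> 1 * norm w"
      using le1 abs_Re_le_cmod by (intro mult_mono) auto
    finally show ?thesis by simp
  qed
  have int: "integrable disk_area (\<lambda>z. \<phi> z *\<^sub>R h z)" if "integrable disk_area h" for h :: "complex \<Rightarrow> complex"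
  proof (rule Bochner_Integration.integrable_bound[OF that])
    show "(\<lambda>z. \<phi> z *\<^sub>R h z) \<in> borel_measurable disk_area"
      using meas that by (intro borel_measurable_scaleR) auto
    show "AE z in disk_area. norm (\<phi> z *\<^sub>R h z) \<le> norm (h z)"
      using le1 by (intro AE_I2) (simp add: mult_left_le_one_le)
  qed
  define I where "I g = (\<integral>z. \<phi> z * Re (\<omega> z - g z) \<partial>disk_area)" for g
  have A1: "integrable disk_area g" if "g \<in> bergman_A1" for g
    using that by (simp add: bergman_A1_def)
  have int_Re: "integrable disk_area (\<lambda>z. \<phi> z * Re (\<omega> z - g z))" if "g \<in> bergman_A1" for g
    using integrable_Re[OF int[of "\<lambda>z. \<omega> z - g z"]] \<omega> A1[OF that] by simp
  have int_norm: "integrable disk_area (\<lambda>z. norm (\<omega> z - g z))" if "g \<in> bergman_A1" for g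
    using \<omega> A1[OF that] by auto
  have I: "I g = Re (\<integral>z. \<phi> z *\<^sub>R \<omega> z \<partial>disk_area)" if "g \<in> bergman_A1" for g
  proof -
    have "I g = Re (\<integral>z. \<phi> z *\<^sub>R (\<omega> z - g z) \<partial>disk_area)"
      unfolding I_def using \<omega> A1[OF that] by (subst integral_Re[symmetric]) (auto intro!: int)
    also have "(\<integral>z. \<phi> z *\<^sub>R (\<omega> z - g z) \<partial>disk_area)
        = (\<integral>z. \<phi> z *\<^sub>R \<omega> z \<partial>disk_area) - (\<integral>z. \<phi> z *\<^sub>R g z \<partial>disk_area)"
      unfolding scaleR_diff_right using \<omega> A1[OF that]
      by (intro Bochner_Integration.integral_diff int)
    finally show ?thesis
      using annihilates[OF that] by simp
  qed
  have I_le: "I g \<le> L1_disk_norm (\<lambda>z. \<omega> z - g z)" if "g \<in> bergman_A1" for g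
    unfolding I_def L1_disk_norm_def using bound
    by (intro integral_mono int_Re int_norm that) 
  have I_f: "I f = L1_disk_norm (\<lambda>z. \<omega> z - f z)"
    unfolding I_def L1_disk_norm_def by (rule Bochner_Integration.integral_cong) (use sign in auto)
  show "best_analytic_approximant \<omega> f"
    unfolding best_analytic_approximant_def using \<omega> f I_f I I_le by metis
  fix g assume best: "best_analytic_approximant \<omega> g"
  then have g: "g \<in> bergman_A1"
    by (simp add: best_analytic_approximant_def)
  \<comment> \<open>Minimality of \<open>g\<close> closes the chain: \<open>I g\<close> is at most
    the norm for \<open>g\<close>, which is at most the norm for \<open>f\<close>, which equals
    \<open>I f = I g\<close>. The nonnegative gap in the bound then has integral 0.\<close>
  have "L1_disk_norm (\<lambda>z. \<omega> z - g z) \<le> L1_disk_norm (\<lambda>z. \<omega> z - f z)"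
    using best f by (simp add: best_analytic_approximant_def)
  then have "L1_disk_norm (\<lambda>z. \<omega> z - g z) = I g"
    using I_le[OF g] I_f I[OF f] I[OF g] by linarith
  then have "(\<integral>z. norm (\<omega> z - g z) - \<phi> z * Re (\<omega> z - g z) \<partial>disk_area) = 0"
    using int_Re[OF g] int_norm[OF g] by (simp only: Bochner_Integration.integral_diff I_def L1_disk_norm_def)
  then have "AE z in disk_area. norm (\<omega> z - g z) - \<phi> z * Re (\<omega> z - g z) = 0"
    using int_Re[OF g] int_norm[OF g] bound by (subst (asm) integral_nonneg_eq_0_iff_AE)
      (auto simp del: minus_complex.sel)
  then show "AE z in disk_area. \<phi> z * Re (\<omega> z - g z) = norm (\<omega> z - g z)"
    by eventually_elim simp
qed

text \<open>The disk of radius \<open>sqrt (1/2)\<close> carries half the area, so the two mean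
  values, 2 * (1/2) * g(0) and g(0), cancel.\<close>

lemma radial_sign_annihilates_bergman:
  assumes "g \<in> bergman_A1"
  shows "(\<integral>z. (2 * indicator (ball 0 (sqrt (1/2))) z - 1 :: real) *\<^sub>R g z \<partial>disk_area) = 0"
proof -
  have g: "g holomorphic_on ball 0 1" "integrable disk_area g"
    using assms by (auto simp: bergman_A1_def)
  have r: "0 < sqrt (1/2 :: real)" "sqrt (1/2 :: real) < 1"
    by auto
  note mv = area_mean_value_inner[OF g(1) r]
  have "(\<integral>z. (2 * indicator (ball 0 (sqrt (1/2))) z - 1 :: real) *\<^sub>R g z \<partial>disk_area)
      = (\<integral>z. 2 *\<^sub>R (indicator (ball 0 (sqrt (1/2))) z *\<^sub>R g z) - g z \<partial>disk_area)"
    by (simp add: scaleR_diff_left)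
  also have "\<dots> = 2 *\<^sub>R (\<integral>z. indicator (ball 0 (sqrt (1/2))) z *\<^sub>R g z \<partial>disk_area) - (\<integral>z. g z \<partial>disk_area)"
    using mv(1) g(2)
    by (subst Bochner_Integration.integral_diff) (auto simp del: scaleR_scaleR intro: integrable_scaleR_right)
  also have "\<dots> = 0"
    unfolding mv(2) area_mean_value[OF assms] by (simp add: scaleR_conv_of_real)
  finally show ?thesis .
qed

text \<open>By the open mapping theorem a nonconstant \<open>f\<close> would have an open image,
  which cannot lie in the real line.\<close>

lemma holomorphic_Im_0_imp_constant:
  assumes "f holomorphic_on S" "open S" "connected S" and Im: "\<And>z. z \<in> S \<Longrightarrow> Im (f z) = 0"
  shows "f constant_on S"
proof (rule ccontr)
  assume not_const: "\<not> f constant_on S"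
  then obtain a where a: "a \<in> S"
    by (auto simp: constant_on_def)
  have "open (f ` S)"
    using assms not_const by (intro open_mapping_thm[where S = S]) auto
  then obtain e where e: "e > 0" "ball (f a) e \<subseteq> f ` S"
    using a by (auto simp: open_contains_ball)
  have "f a + \<i> * of_real (e / 2) \<in> ball (f a) e"
    using e(1) by (simp add: dist_norm norm_mult)
  then obtain b where "b \<in> S" "f b = f a + \<i> * of_real (e / 2)"
    using e(2) by (metis image_iff subset_iff)
  then show False
    using Im[of b] Im[OF a] e(1) by simp
qed

section \<open>The continuous target and its best approximant\<close>

text \<open>The factor exceeds \<open>1\<close> exactly for \<open>(norm z)\<^sup>2 < 1/2\<close> and vanishes near the unit circle, where
  \<open>sqrt_log_sum\<close> is unbounded (and takes junk values on the circle itself).\<close>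

definition radial_cutoff :: "complex \<Rightarrow> real" where
  "radial_cutoff z = max 0 (3 - 4 * (norm z)\<^sup>2)"

text \<open>The imaginary part is given by \<open>Im_sqrt_log_sum\<close>, which agrees with that of
  \<open>sqrt_log_sum\<close> inside the disk and is continuous up to the boundary.\<close>

definition cutoff_target :: "complex \<Rightarrow> complex" where
  "cutoff_target z = Complex (radial_cutoff z * Re (sqrt_log_sum z)) (Im_sqrt_log_sum z)"

lemma continuous_on_cutoff_target: "continuous_on (cball 0 1) cutoff_target"
proof -
  let ?g = "\<lambda>z. radial_cutoff z * Re (sqrt_log_sum z)"
  have cont: "continuous_on (ball 0 1) sqrt_log_sum"
    by (intro holomorphic_on_imp_continuous_on holomorphic_sqrt_log_sum)
  \<comment> \<open>The cutoff vanishes once |z|^2 is at least 3/4, and (9/10)^2 = 0.81 exceeds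
    this: the product is continuous on the inner disk and zero on the closed annulus.\<close>
  have "continuous_on (cball 0 (9/10) \<union> (cball 0 1 - ball 0 (9/10))) ?g"
  proof (rule continuous_on_closed_Un)
    show "continuous_on (cball 0 (9/10)) ?g"
      unfolding radial_cutoff_def
      by (intro continuous_intros continuous_on_subset[OF cont]) auto
    have "?g z = 0" if "z \<in> cball 0 1 - ball 0 (9/10)" for z
    proof -
      have "(9/10)\<^sup>2 \<le> (norm z)\<^sup>2"
        using that by (intro power_mono) auto
      then show ?thesis
        by (simp add: radial_cutoff_def power2_eq_square)
    qed
    then show "continuous_on (cball 0 1 - ball 0 (9/10)) ?g"
      by (subst continuous_on_cong[OF refl, where g = "\<lambda>_. 0"]) auto
  qed auto
  moreover have "cball 0 (9/10) \<union> (cball 0 1 - ball 0 (9/10)) = (cball 0 1 :: complex set)"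
    by auto
  ultimately show ?thesis
    unfolding cutoff_target_def[abs_def] Complex_eq
    by (intro continuous_on_add continuous_on_mult_left continuous_on_of_real
        continuous_on_Im_sqrt_log_sum) simp
qed

lemma cutoff_target_minus_sqrt_log_sum:
  assumes "norm z < 1"
  shows "cutoff_target z - sqrt_log_sum z = of_real ((radial_cutoff z - 1) * Re (sqrt_log_sum z))"
  using Im_sqrt_log_sum[OF assms] by (simp add: complex_eq_iff cutoff_target_def algebra_simps)

text \<open>As \<open>Re (sqrt_log_sum z)\<close> is positive, the real error has the sign of
  \<open>radial_cutoff z - 1\<close>, which changes at radius \<open>sqrt (1/2)\<close>.\<close>

lemma norm_cutoff_target_minus_sqrt_log_sum:
  assumes "norm z < 1"
  shows "(2 * indicator (ball 0 (sqrt (1/2))) z - 1) * Re (cutoff_target z - sqrt_log_sum z)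
    = norm (cutoff_target z - sqrt_log_sum z)"
proof (cases "z \<in> ball 0 (sqrt (1/2))")
  case True
  then have "(norm z)\<^sup>2 < 1/2"
    using real_less_rsqrt real_sqrt_less_iff[of "(norm z)\<^sup>2" "1/2"] by simp
  then have "0 \<le> (radial_cutoff z - 1) * Re (sqrt_log_sum z)"
    using Re_sqrt_log_sum_pos[OF assms] by (intro mult_nonneg_nonneg) (auto simp: radial_cutoff_def)
  then show ?thesis
    unfolding cutoff_target_minus_sqrt_log_sum[OF assms] norm_of_real using True by simp
next
  case False
  then have "1/2 \<le> (norm z)\<^sup>2"
    using real_sqrt_le_iff[of "1/2" "(norm z)\<^sup>2"] by simp
  then have "(radial_cutoff z - 1) * Re (sqrt_log_sum z) \<le> 0"
    using Re_sqrt_log_sum_pos[OF assms] by (intro mult_nonpos_nonneg) (auto simp: radial_cutoff_def)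
  then show ?thesis
    unfolding cutoff_target_minus_sqrt_log_sum[OF assms] norm_of_real using False by simp
qed

lemma integrable_cutoff_target: "integrable disk_area cutoff_target"
proof -
  have "bounded (cutoff_target ` cball 0 1)"
    by (intro compact_imp_bounded compact_continuous_image continuous_on_cutoff_target) auto
  then obtain B where "\<forall>w \<in> cutoff_target ` cball 0 1. norm w \<le> B"
    unfolding bounded_iff by blast
  then show ?thesis
    by (intro disk_area.integrable_const_bound[where B = B] AE_I2
        borel_measurable_disk_area_continuous continuous_on_subset[OF continuous_on_cutoff_target]) auto
qed

lemma best_analytic_approximant_cutoff_target: "best_analytic_approximant cutoff_target sqrt_log_sum"
  and best_analytic_approximant_cutoff_target_sign: "best_analytic_approximant cutoff_target g \<Longrightarrow>
    AE z in disk_area. (2 * indicator (ball 0 (sqrt (1/2))) z - 1) * Re (cutoff_target z - g z)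
      = norm (cutoff_target z - g z)"
proof -
  let ?\<phi> = "\<lambda>z :: complex. 2 * indicator (ball 0 (sqrt (1/2))) z - 1 :: real"
  have meas: "?\<phi> \<in> borel_measurable disk_area"
    by measurable
  have le1: "\<bar>?\<phi> z\<bar> \<le> 1" for z
    by (simp add: indicator_def)
  have sign: "?\<phi> z * Re (cutoff_target z - sqrt_log_sum z) = norm (cutoff_target z - sqrt_log_sum z)"
    if "z \<in> ball 0 1" for z
    using that by (intro norm_cutoff_target_minus_sqrt_log_sum) simp
  note dual = integrable_cutoff_target sqrt_log_sum_bergman meas le1
    radial_sign_annihilates_bergman sign
  show "best_analytic_approximant cutoff_target sqrt_log_sum"
    by (rule best_analytic_approximant_dual[OF dual])
  show "best_analytic_approximant cutoff_target g \<Longrightarrow>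
      AE z in disk_area. ?\<phi> z * Re (cutoff_target z - g z) = norm (cutoff_target z - g z)"
    by (rule best_analytic_approximant_sign[OF dual])
qed

text \<open>By continuity the sign condition holds pointwise off the circle of radius
  \<open>sqrt (1/2)\<close>, and the error of \<open>g\<close> is real on the whole disk. So
  \<open>sqrt_log_sum - g\<close> is a real constant. On the circle the error of
  \<open>sqrt_log_sum\<close> vanishes, and that of \<open>g\<close> vanishes because it changes
  sign there.\<close>

lemma best_analytic_approximant_cutoff_target_unique:
  assumes best: "best_analytic_approximant cutoff_target g" and z: "norm z < 1"
  shows "g z = sqrt_log_sum z"
proof -
  let ?h = "\<lambda>z. cutoff_target z - g z"
  let ?\<rho> = "sqrt (1/2 :: real)"
  have \<rho>: "0 < ?\<rho>" "?\<rho> < 1"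
    by auto
  have g: "g holomorphic_on ball 0 1"
    using best by (simp add: best_analytic_approximant_def bergman_A1_def)
  have cont: "continuous_on (ball 0 1) ?h"
    by (intro continuous_intros holomorphic_on_imp_continuous_on[OF g]
        continuous_on_subset[OF continuous_on_cutoff_target]) auto
  note AE = best_analytic_approximant_cutoff_target_sign[OF best]
  have inner: "Re (?h w) = norm (?h w)" if "w \<in> ball 0 ?\<rho>" for w
  proof -
    have "Re (?h w) - norm (?h w) = 0"
    proof (rule continuous_AE_disk_area_eq_0[OF _ _ _ _ that])
      show "AE w in disk_area. w \<in> ball 0 ?\<rho> \<longrightarrow> Re (?h w) - norm (?h w) = 0"
        using AE by eventually_elim (auto simp: indicator_def)
      show sub: "ball 0 ?\<rho> \<subseteq> (ball 0 1 :: complex set)"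
        using \<rho> by (intro subset_ball) simp
      show "continuous_on (ball 0 ?\<rho>) (\<lambda>w. Re (?h w) - norm (?h w))"
        by (intro continuous_on_diff continuous_on_Re continuous_on_norm continuous_on_subset[OF cont sub])
    qed simp
    then show ?thesis by simp
  qed
  \<comment> \<open>The closed inner disk is removed to leave an open set, as the passage from
    almost everywhere to everywhere requires; the circle is treated by limits below.\<close>
  have outer: "- Re (?h w) = norm (?h w)" if "w \<in> ball 0 1 - cball 0 ?\<rho>" for w
  proof -
    have "- Re (?h w) - norm (?h w) = 0"
    proof (rule continuous_AE_disk_area_eq_0[OF _ _ _ _ that])
      show "AE w in disk_area. w \<in> ball 0 1 - cball 0 ?\<rho> \<longrightarrow> - Re (?h w) - norm (?h w) = 0"
        using AE by eventually_elim (auto simp: indicator_def)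
      show "continuous_on (ball 0 1 - cball 0 ?\<rho>) (\<lambda>w. - Re (?h w) - norm (?h w))"
        by (intro continuous_on_diff continuous_on_minus continuous_on_Re continuous_on_norm
            continuous_on_subset[OF cont]) auto
    qed auto
    then show ?thesis by simp
  qed
  \<comment> \<open>Both signs give |Re| = norm, so this works on the whole disk at once, circle
    included.\<close>
  have Im_0: "Im (?h w) = 0" if "w \<in> ball 0 1" for w
  proof (rule continuous_AE_disk_area_eq_0[OF _ _ _ _ that])
    show "AE w in disk_area. w \<in> ball 0 1 \<longrightarrow> Im (?h w) = 0"
      using AE
    proof eventually_elim
      case (elim w)
      have "\<bar>Re (?h w)\<bar> = norm (?h w)"
        using elim abs_Re_le_cmod[of "?h w"] by (cases "norm w < ?\<rho>") auto
      then show ?case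
        using cmod_power2[of "?h w"] by (metis add_cancel_right_right power2_abs power_eq_0_iff)
    qed
    show "continuous_on (ball 0 1) (\<lambda>w. Im (?h w))"
      by (intro continuous_on_Im cont)
  qed auto
  have diff: "Im (sqrt_log_sum w - g w) = 0" if "w \<in> ball 0 1" for w
    using Im_0[OF that] cutoff_target_minus_sqrt_log_sum[of w] that by (simp add: complex_eq_iff)
  have "(\<lambda>w. sqrt_log_sum w - g w) constant_on ball 0 1"
    using diff by (intro holomorphic_Im_0_imp_constant holomorphic_on_diff holomorphic_sqrt_log_sum g) auto
  then obtain c where c: "\<And>w. w \<in> ball 0 1 \<Longrightarrow> sqrt_log_sum w - g w = c"
    by (auto simp: constant_on_def)
  \<comment> \<open>A point of the circle where the sign changes, approached along the real axis
    from both sides.\<close>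
  let ?z = "of_real ?\<rho> :: complex"
  have z_ball: "?z \<in> ball 0 1"
    using \<rho> by (simp only: mem_ball_0 norm_of_real)
  have "isCont ?h ?z"
    using cont z_ball by (simp only: continuous_on_eq_continuous_at open_ball)
  then have "isCont (\<lambda>t. ?h (of_real t)) ?\<rho>"
    by (rule isCont_o2[rotated]) simp
  then have lim: "((\<lambda>t. Re (?h (of_real t))) \<longlongrightarrow> Re (?h ?z)) (at ?\<rho>)"
    unfolding isCont_def by (rule tendsto_Re)
  have "0 \<le> Re (?h ?z)"
  proof (rule tendsto_lowerbound)
    show "((\<lambda>t. Re (?h (of_real t))) \<longlongrightarrow> Re (?h ?z)) (at_left ?\<rho>)"
      using lim by (rule tendsto_within_subset) simp
    have "eventually (\<lambda>t. t \<in> {0<..<?\<rho>}) (at_left ?\<rho>)"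
      using \<rho> by (intro eventually_at_left_real)
    then show "eventually (\<lambda>t. 0 \<le> Re (?h (of_real t))) (at_left ?\<rho>)"
    proof eventually_elim
      case (elim t)
      then have "of_real t \<in> ball (0 :: complex) ?\<rho>" by simp
      then show ?case using inner norm_ge_zero by metis
    qed
  qed simp
  moreover have "Re (?h ?z) \<le> 0"
  proof (rule tendsto_upperbound)
    show "((\<lambda>t. Re (?h (of_real t))) \<longlongrightarrow> Re (?h ?z)) (at_right ?\<rho>)"
      using lim by (rule tendsto_within_subset) simp
    have "eventually (\<lambda>t. t \<in> {?\<rho><..<1}) (at_right ?\<rho>)"
      using \<rho> by (intro eventually_at_right_real)
    then show "eventually (\<lambda>t. Re (?h (of_real t)) \<le> 0) (at_right ?\<rho>)"
    proof eventually_elim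
      case (elim t)
      then have "0 < t"
        using \<rho>(1) unfolding greaterThanLessThan_iff by linarith
      then have "of_real t \<in> ball (0 :: complex) 1 - cball 0 ?\<rho>"
        using elim by simp
      then show ?case using outer norm_ge_zero by (metis neg_0_le_iff_le)
    qed
  qed simp
  ultimately have "Re (?h ?z) = 0" by simp
  \<comment> \<open>Here |z|^2 = 1/2 and 3 - 4/2 = 1, so the target meets
    \<open>sqrt_log_sum\<close> and \<open>c\<close> is the error of \<open>g\<close> at this
    point.\<close>
  moreover have "radial_cutoff ?z = 1"
    by (simp add: radial_cutoff_def real_sqrt_divide power_divide norm_divide)
  then have "cutoff_target ?z = sqrt_log_sum ?z"
    using cutoff_target_minus_sqrt_log_sum[of ?z] z_ball by simp
  ultimately have "Re c = 0"
    using c[OF z_ball] by simp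
  moreover have "Im c = 0"
    using c[of 0] diff[of 0] by simp
  ultimately have "c = 0"
    by (simp add: complex_eq_iff)
  then show ?thesis
    using c[of z] z by simp
qed

text \<open>Uniqueness is equality on the open disk, since values elsewhere affect neither
  membership in \<open>bergman_A1\<close> nor the norm.\<close>

theorem proposition7p6:
  "\<exists>\<omega> :: complex \<Rightarrow> complex.
     continuous_on (cball 0 1) \<omega> \<and>
     (\<exists>f. best_analytic_approximant \<omega> f \<and>
          (\<forall>g. best_analytic_approximant \<omega> g \<longrightarrow> (\<forall>z \<in> ball 0 1. g z = f z)) \<and>
          unbounded_near_every_boundary_point f)"
proof (intro exI conjI allI impI ballI)
  show "continuous_on (cball 0 1) cutoff_target"
    by (fact continuous_on_cutoff_target)
  show "best_analytic_approximant cutoff_target sqrt_log_sum"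
    by (fact best_analytic_approximant_cutoff_target)
  show "g z = sqrt_log_sum z" if "best_analytic_approximant cutoff_target g" "z \<in> ball 0 1" for g z
    using that by (simp add: best_analytic_approximant_cutoff_target_unique)
  show "unbounded_near_every_boundary_point sqrt_log_sum"
    by (fact unbounded_sqrt_log_sum)
qed

end
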